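(* Let $G$ be a finite simple graph on $n$ vertices. If \[ \delta(G) \geq \frac{n}{2} + \frac{\ln n}{\ln (4/3)}, \] then $\overrightarrow{\mathrm{diam}}(G) = 2$, i.e., $G$ has an orientation of diameter two.
   Context: $\delta(G)$ denotes the minimum degree of $G$ and $\ln$ is the natural logarithm. An orientation of $G$ is a digraph obtained by assigning a direction to each edge of $G$. A digraph is strong if there is a directed path between any ordered pair of vertices; the diameter of a strong digraph is the maximum, over ordered pairs $(u,v)$ of vertices, of the length of a shortest directed $(u,v)$-path. The oriented diameter $\overrightarrow{\mathrm{diam}}(G)$ of a graph $G$ is the minimum diameter among all strong orientations of $G$. An orientation has diameter two means that for every ordered pair of distinct vertices $u,v$ there is a directed path of length at most $2$ from $u$ to $v$ (and some pair is non-adjacent or the diameter is otherwise not $1$). *)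

theory Defs
  imports Complex_Main "HOL-Library.Extended_Nat" "Graph_Theory.Graph_Theory"
begin

text \<open>
  A finite simple graph is a \<^locale>\<open>pair_graph\<close>: a finite loop-free digraph with symmetric arc
  relation, each edge being represented by its two opposite arcs. Hence the degree of a vertex is
  its out-degree.
\<close>

definition min_degree :: "'a pair_pre_digraph \<Rightarrow> nat" where
  "min_degree G = Min (out_degree (with_proj G) ` pverts G)"

text \<open>Exactly one of the two opposite arcs of every edge is kept.\<close>

definition is_orientation :: "'a pair_pre_digraph \<Rightarrow> 'a pair_pre_digraph \<Rightarrow> bool" where
  "is_orientation G D \<longleftrightarrow>
     pverts D = pverts G \<and>
     parcs D \<subseteq> parcs G \<and>
     (\<forall>(u, v) \<in> parcs G. ((u, v) \<in> parcs D) \<noteq> ((v, u) \<in> parcs D))"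

text \<open>The infimum over the empty set is \<open>\<infinity>\<close>; a nonempty infimum in \<^typ>\<open>enat\<close> is a minimum.\<close>

definition digraph_dist :: "('a, 'b) pre_digraph \<Rightarrow> 'a \<Rightarrow> 'a \<Rightarrow> enat" where
  "digraph_dist D u v = (INF p \<in> {p. pre_digraph.apath D u p v}. enat (length p))"

definition digraph_diameter :: "('a, 'b) pre_digraph \<Rightarrow> enat" where
  "digraph_diameter D = (SUP (u, v) \<in> verts D \<times> verts D. digraph_dist D u v)"

definition oriented_diameter :: "'a pair_pre_digraph \<Rightarrow> enat" where
  "oriented_diameter G =
     (INF D \<in> {D. is_orientation G D \<and> strongly_connected (with_proj D)}.
        digraph_diameter (with_proj D))"

end

theory Submission
  imports Defs
begin

text \<open>
  Orient every edge independently by a fair coin. Two distinct vertices \<open>u\<close>, \<open>v\<close> have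
  \<open>c \<ge> 2\<delta> - n \<ge> 2 ln n / ln (4/3)\<close> common neighbours, and the pairs of edges \<open>uw\<close>, \<open>wv\<close> are
  disjoint for distinct \<open>w\<close>. So no path \<open>u \<rightarrow> w \<rightarrow> v\<close> exists with probability
  \<open>(3/4)^c \<le> 1/n\<^sup>2\<close>. There are only \<open>n (n - 1) < n\<^sup>2\<close> ordered pairs, so by the union bound some
  orientation has a path of length two between any two distinct vertices. No orientation of a
  graph with at least two vertices has diameter less than two.
\<close>

text \<open>This is independence in counting form: on disjoint blocks \<open>B w\<close>, the events
  "the trace of \<open>S\<close> on \<open>B w\<close> is \<open>T w\<close>" are independent, and
  each is missed with probability 1 - 1 / 2 ^ card (B w). Denominators are multiplied out so that
  the identity lives in \<open>nat\<close>.\<close>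

lemma card_Pow_avoiding_blocks:
  fixes B T :: "'i \<Rightarrow> 'e set"
  assumes "finite C" "finite A" "\<And>w. w \<in> C \<Longrightarrow> B w \<subseteq> A" "\<And>w. w \<in> C \<Longrightarrow> T w \<subseteq> B w"
    and "disjoint_family_on B C"
  shows "card {S \<in> Pow A. \<forall>w\<in>C. S \<inter> B w \<noteq> T w} * (\<Prod>w\<in>C. 2 ^ card (B w)) =
    (\<Prod>w\<in>C. 2 ^ card (B w) - 1) * 2 ^ card A"
  using assms
proof (induction C arbitrary: A rule: finite_induct)
  case empty
  then show ?case by (simp add: card_Pow Pow_def[symmetric])
next
  case (insert x C)
  \<comment> \<open>The block of \<open>x\<close> is split off; \<open>A\<close> is arbitrary in the
    induction so that the hypothesis applies to the smaller ground set.\<close>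
  define A' where "A' = A - B x"
  let ?R = "{S \<in> Pow A'. \<forall>w\<in>C. S \<inter> B w \<noteq> T w}"
  let ?L = "{S \<in> Pow A. \<forall>w\<in>insert x C. S \<inter> B w \<noteq> T w}"
  have dj: "B w \<inter> B x = {}" if "w \<in> C" for w
  proof -
    have "w \<noteq> x" using insert.hyps(2) that by blast
    then show ?thesis
      using disjoint_family_onD[OF insert.prems(4), of w x] that by simp
  qed
  have IH: "card ?R * (\<Prod>w\<in>C. 2 ^ card (B w)) = (\<Prod>w\<in>C. 2 ^ card (B w) - 1) * 2 ^ card A'"
  proof (rule insert.IH)
    show "finite A'" using insert.prems(1) by (simp add: A'_def)
    show "B w \<subseteq> A'" if "w \<in> C" for w
      using insert.prems(2)[of w] dj[OF that] that by (auto simp: A'_def)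
    show "T w \<subseteq> B w" if "w \<in> C" for w using insert.prems(3)[of w] that by simp
    show "disjoint_family_on B C"
      using insert.prems(4) by (auto simp: disjoint_family_on_def)
  qed
  have BxA: "B x \<subseteq> A" and TxB: "T x \<subseteq> B x" using insert.prems by auto
  have fB: "finite (B x)" using BxA insert.prems(1) finite_subset by blast
  \<comment> \<open>Deleting \<open>B x\<close> leaves the other traces unchanged, so the conditions
    on \<open>S \<inter> B x\<close> and on \<open>S - B x\<close> can be met independently of each
    other.\<close>
  have restrict: "(S - B x) \<inter> B w = S \<inter> B w" if "w \<in> C" for S w using dj[OF that] by blast
  have "bij_betw (\<lambda>S. (S \<inter> B x, S - B x)) ?L ((Pow (B x) - {T x}) \<times> ?R)"
  proof (rule bij_betw_byWitness[where f' = "\<lambda>(X, Y). X \<union> Y"])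
    show "(\<lambda>S. (S \<inter> B x, S - B x)) ` ?L \<subseteq> (Pow (B x) - {T x}) \<times> ?R"
      using restrict by (auto simp: A'_def)
    show "(\<lambda>(X, Y). X \<union> Y) ` ((Pow (B x) - {T x}) \<times> ?R) \<subseteq> ?L"
    proof (rule image_subsetI)
      fix p assume p: "p \<in> (Pow (B x) - {T x}) \<times> ?R"
      obtain X Y where XY: "p = (X, Y)" by fastforce
      have X: "X \<subseteq> B x" "X \<noteq> T x" and Y: "Y \<subseteq> A'" "\<forall>w\<in>C. Y \<inter> B w \<noteq> T w"
        using p by (auto simp: XY)
      have "(X \<union> Y) \<inter> B x = X" using X Y by (auto simp: A'_def)
      moreover have "(X \<union> Y) \<inter> B w = Y \<inter> B w" if "w \<in> C" for w using X dj[OF that] by blast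
      moreover have "X \<union> Y \<subseteq> A" using X Y BxA by (auto simp: A'_def)
      ultimately show "(case p of (X, Y) \<Rightarrow> X \<union> Y) \<in> ?L"
        using X(2) Y(2) by (simp add: XY)
    qed
  qed (auto simp: A'_def)
  then have "card ?L = card (Pow (B x) - {T x}) * card ?R"
    by (simp add: bij_betw_same_card card_cartesian_product)
  also have "card (Pow (B x) - {T x}) = 2 ^ card (B x) - 1"
    using TxB fB by (simp add: card_Diff_singleton card_Pow)
  finally have L: "card ?L = (2 ^ card (B x) - 1) * card ?R" .
  have "card A = card (B x) + card A'"
    using BxA fB insert.prems(1) by (simp add: A'_def card_Diff_subset card_mono)
  then have A: "(2::nat) ^ card A = 2 ^ card (B x) * 2 ^ card A'" by (simp add: power_add)
  have "card ?L * (\<Prod>w\<in>insert x C. 2 ^ card (B w)) =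
      (2 ^ card (B x) - 1) * 2 ^ card (B x) * (card ?R * (\<Prod>w\<in>C. 2 ^ card (B w)))"
    by (simp only: L prod.insert[OF insert.hyps] mult_ac)
  also have "\<dots> = (\<Prod>w\<in>insert x C. 2 ^ card (B w) - 1) * 2 ^ card A"
    by (simp only: IH) (simp only: A prod.insert[OF insert.hyps] mult_ac)
  finally show ?case .
qed

text \<open>Exponentiating the hypothesis gives n^2 = exp (2 ln n) \<le> (4/3)^c; taking reciprocals
  finishes. The base 4/3 of the logarithm is the inverse of the failure probability 3/4 of one
  common neighbour.\<close>

lemma three_quarters_power_le:
  assumes "n > 0" and "real c \<ge> 2 * (ln (real n) / ln (4 / 3))"
  shows "(3 / 4) ^ c \<le> 1 / (real n)\<^sup>2"
proof -
  have l: "ln (4 / 3 :: real) > 0" by simp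
  have "(real n)\<^sup>2 = exp (2 * ln (real n))"
    using assms(1) by (simp add: exp_double)
  also have "\<dots> \<le> exp (real c * ln (4 / 3))"
    using assms(2) l by (simp add: field_simps)
  also have "\<dots> = (4 / 3) ^ c"
    by (simp add: exp_of_nat_mult)
  finally have "1 / (4 / 3 :: real) ^ c \<le> 1 / (real n)\<^sup>2"
    using assms(1) by (intro divide_left_mono) auto
  then show ?thesis by (simp add: power_divide)
qed

section \<open>Neighbourhoods, and orientations coded by sets of edges\<close>

definition neighbours :: "'a pair_pre_digraph \<Rightarrow> 'a \<Rightarrow> 'a set" where
  "neighbours G u = {w. (u, w) \<in> parcs G}"

text \<open>Opposite arcs give the same doubleton, so each edge gets a single coin and the subsets
  of \<open>edges G\<close> are the equally likely outcomes.\<close>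

definition edges :: "'a pair_pre_digraph \<Rightarrow> 'a set set" where
  "edges G = (\<lambda>(a, b). {a, b}) ` parcs G"

text \<open>
  Relative to the numbering \<open>idx\<close> of the vertices, the edges in \<open>S\<close> point upwards and all other
  edges point downwards.
\<close>

definition orient :: "('a \<Rightarrow> nat) \<Rightarrow> 'a pair_pre_digraph \<Rightarrow> 'a set set \<Rightarrow> 'a pair_pre_digraph" where
  "orient idx G S = \<lparr>pverts = pverts G,
     parcs = {(a, b) \<in> parcs G. {a, b} \<in> S \<longleftrightarrow> idx a < idx b}\<rparr>"

context pair_graph
begin

lemma finite_neighbours: "finite (neighbours G u)"
  and neighbours_subset: "neighbours G u \<subseteq> pverts G"
proof -
  show *: "neighbours G u \<subseteq> pverts G"
    using in_arcsD2 by (auto simp: neighbours_def)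
  show "finite (neighbours G u)"
    using * pair_finite_verts by (rule finite_subset)
qed

lemma neighbours_sym: "w \<in> neighbours G u \<longleftrightarrow> u \<in> neighbours G w"
  unfolding neighbours_def mem_Collect_eq using arcs_symmetric by metis

lemma neighbours_irrefl: "u \<notin> neighbours G u"
  by (auto simp: neighbours_def dest: no_loops)

lemma card_neighbours: "card (neighbours G u) = out_degree (with_proj G) u"
proof -
  have "out_arcs (with_proj G) u = Pair u ` neighbours G u"
    by (auto simp: out_arcs_def neighbours_def)
  then show ?thesis
    by (simp add: out_degree_def card_image inj_on_def)
qed

lemma min_degree_le: "u \<in> pverts G \<Longrightarrow> min_degree G \<le> card (neighbours G u)"
  unfolding min_degree_def card_neighbours using pair_finite_verts by (intro Min_le) auto

text \<open>Inclusion-exclusion, with the union of both neighbourhoods inside the vertex set. The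
  additive form avoids truncated subtraction.\<close>

lemma common_neighbours_ge:
  assumes "u \<in> pverts G" "v \<in> pverts G"
  shows "2 * min_degree G \<le> card (neighbours G u \<inter> neighbours G v) + card (pverts G)"
proof -
  have "card (neighbours G u \<union> neighbours G v) \<le> card (pverts G)"
    using neighbours_subset pair_finite_verts by (intro card_mono) auto
  moreover have "card (neighbours G u) + card (neighbours G v) =
      card (neighbours G u \<union> neighbours G v) + card (neighbours G u \<inter> neighbours G v)"
    using finite_neighbours by (intro card_Un_Int)
  ultimately show ?thesis
    using min_degree_le[OF assms(1)] min_degree_le[OF assms(2)] by linarith
qed

lemma min_degree_less:
  assumes "pverts G \<noteq> {}"
  shows "min_degree G < card (pverts G)"
proof -
  obtain u where u: "u \<in> pverts G" using assms by blast
  have "neighbours G u \<subset> pverts G"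
    using neighbours_subset neighbours_irrefl u by blast
  then have "card (neighbours G u) < card (pverts G)"
    using pair_finite_verts by (rule psubset_card_mono[rotated])
  then show ?thesis using min_degree_le[OF u] by simp
qed

lemma finite_edges: "finite (edges G)"
  by (simp add: edges_def)

text \<open>Injectivity makes exactly one of \<open>idx a < idx b\<close> and
  \<open>idx b < idx a\<close> true for the ends of an edge, so membership of the edge in
  \<open>S\<close> selects exactly one of its two arcs.\<close>

lemma orient_is_orientation:
  assumes "inj_on idx (pverts G)"
  shows "is_orientation G (orient idx G S)"
proof -
  have "((a, b) \<in> parcs (orient idx G S)) \<noteq> ((b, a) \<in> parcs (orient idx G S))"
    if ab: "(a, b) \<in> parcs G" for a b
  proof -
    have "idx a \<noteq> idx b"
      using assms no_loops[OF ab] in_arcsD1[OF ab] in_arcsD2[OF ab] by (auto dest: inj_onD)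
    moreover have "(b, a) \<in> parcs G" using ab by (rule arcs_symmetric)
    ultimately show ?thesis using ab by (auto simp: orient_def insert_commute)
  qed
  then show ?thesis by (auto simp: is_orientation_def orient_def)
qed

text \<open>Each common neighbour \<open>w\<close> owns a block of two edges, and one of the four
  outcomes on it yields the path through \<open>w\<close>. The blocks are disjoint, so the counting
  lemma applies with factors 4 and 4 - 1 = 3.\<close>

lemma card_orientations_without_two_path:
  assumes "u \<noteq> v"
  defines "C \<equiv> neighbours G u \<inter> neighbours G v"
  shows "card {S \<in> Pow (edges G).
      \<forall>w. \<not> ((u, w) \<in> parcs (orient idx G S) \<and> (w, v) \<in> parcs (orient idx G S))} * 4 ^ card C =
    3 ^ card C * 2 ^ card (edges G)"
proof -
  define B where "B w = {{u, w}, {w, v}}" for w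
  \<comment> \<open>The unique trace on \<open>B w\<close> that directs both edges along the path:
    an edge must lie in \<open>S\<close> exactly when the wanted direction goes up in
    \<open>idx\<close>.\<close>
  define T where "T w = {e. e = {u, w} \<and> idx u < idx w \<or> e = {w, v} \<and> idx w < idx v}" for w
  have C: "(u, w) \<in> parcs G" "(w, v) \<in> parcs G" "w \<noteq> u" "w \<noteq> v" if "w \<in> C" for w
  proof -
    show arcs: "(u, w) \<in> parcs G" "(w, v) \<in> parcs G"
      using that neighbours_sym[of w v] by (simp_all add: C_def neighbours_def)
    show "w \<noteq> u" "w \<noteq> v" using arcs[THEN no_loops] by auto
  qed
  have inC: "w \<in> C" if "(u, w) \<in> parcs G" "(w, v) \<in> parcs G" for w
    using that(1) arcs_symmetric[OF that(2)] by (simp add: C_def neighbours_def)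
  have cardB: "card (B w) = 2" for w
    using assms(1) by (auto simp: B_def doubleton_eq_iff card_insert_if)
  have block: "S \<inter> {e, f} = {x. x = e \<and> p \<or> x = f \<and> q} \<longleftrightarrow> (e \<in> S \<longleftrightarrow> p) \<and> (f \<in> S \<longleftrightarrow> q)"
    if "e \<noteq> f" for e f :: "'a set" and S p q
    using that by (cases p; cases q) auto
  have good: "(u, w) \<in> parcs (orient idx G S) \<and> (w, v) \<in> parcs (orient idx G S) \<longleftrightarrow> S \<inter> B w = T w"
    if "w \<in> C" for w S
  proof -
    have "{u, w} \<noteq> {w, v}" using assms(1) by (auto simp: doubleton_eq_iff)
    then have "S \<inter> B w = T w \<longleftrightarrow>
        ({u, w} \<in> S \<longleftrightarrow> idx u < idx w) \<and> ({w, v} \<in> S \<longleftrightarrow> idx w < idx v)"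
      unfolding B_def T_def by (rule block)
    then show ?thesis using C[OF that] by (auto simp: orient_def)
  qed
  have "{S \<in> Pow (edges G).
      \<forall>w. \<not> ((u, w) \<in> parcs (orient idx G S) \<and> (w, v) \<in> parcs (orient idx G S))} =
      {S \<in> Pow (edges G). \<forall>w\<in>C. S \<inter> B w \<noteq> T w}"
  proof (rule Collect_cong, rule conj_cong[OF refl])
    fix S
    have "w \<in> C" if "(u, w) \<in> parcs (orient idx G S)" "(w, v) \<in> parcs (orient idx G S)" for w
      using that by (intro inC) (auto simp: orient_def)
    then show "(\<forall>w. \<not> ((u, w) \<in> parcs (orient idx G S) \<and> (w, v) \<in> parcs (orient idx G S))) =
        (\<forall>w\<in>C. S \<inter> B w \<noteq> T w)"
      using good by blast
  qed
  moreover have "card {S \<in> Pow (edges G). \<forall>w\<in>C. S \<inter> B w \<noteq> T w} * (\<Prod>w\<in>C. 2 ^ card (B w)) =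
    (\<Prod>w\<in>C. 2 ^ card (B w) - 1) * 2 ^ card (edges G)"
  proof (rule card_Pow_avoiding_blocks)
    show "finite C" using finite_neighbours by (simp add: C_def)
    show "B w \<subseteq> edges G" if "w \<in> C" for w
      using C[OF that] by (force simp: B_def edges_def)
    show "T w \<subseteq> B w" for w by (auto simp: T_def B_def)
    show "disjoint_family_on B C"
      unfolding disjoint_family_on_def
    proof (intro ballI impI)
      \<comment> \<open>An edge of \<open>B w\<close> has \<open>w\<close> as its only end outside
        {u, v}, so it determines its block.\<close>
      fix w w' assume "w \<in> C" "w' \<in> C" "w \<noteq> w'"
      then show "B w \<inter> B w' = {}"
        using C(3,4)[of w] C(3,4)[of w'] assms(1) by (auto simp: B_def doubleton_eq_iff)
    qed
  qed (rule finite_edges)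
  ultimately show ?thesis by (simp add: cardB)
qed

section \<open>The union bound over ordered pairs of vertices\<close>

lemma exists_orientation_with_two_paths:
  assumes "pverts G \<noteq> {}"
    and "real (min_degree G) \<ge> real (card (pverts G)) / 2 + ln (real (card (pverts G))) / ln (4 / 3)"
  obtains D where "is_orientation G D"
    and "\<And>u v. \<lbrakk>u \<in> pverts G; v \<in> pverts G; u \<noteq> v\<rbrakk> \<Longrightarrow> \<exists>w. (u, w) \<in> parcs D \<and> (w, v) \<in> parcs D"
proof -
  define n where "n = card (pverts G)"
  have n0: "n > 0" using assms(1) pair_finite_verts by (simp add: n_def card_gt_0_iff)
  obtain idx :: "'a \<Rightarrow> nat" where idx: "inj_on idx (pverts G)"
    using finite_imp_inj_to_nat_seg[OF pair_finite_verts] by blast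
  define bad where "bad = (\<lambda>(u, v). {S \<in> Pow (edges G).
      \<forall>w. \<not> ((u, w) \<in> parcs (orient idx G S) \<and> (w, v) \<in> parcs (orient idx G S))})"
  define P where "P = {(u, v). u \<in> pverts G \<and> v \<in> pverts G \<and> u \<noteq> v}"
  have P_eq: "P = pverts G \<times> pverts G - Id_on (pverts G)" by (auto simp: P_def)
  have finP: "finite P" using pair_finite_verts by (simp add: P_eq)
  \<comment> \<open>The missing diagonal makes this inclusion strict. The bound on each bad set is
    not strict, so this is where the strictness of the union bound comes from.\<close>
  have "P \<subset> pverts G \<times> pverts G" using assms(1) by (auto simp: P_def)
  then have "card P < card (pverts G \<times> pverts G)"
    using pair_finite_verts by (intro psubset_card_mono) auto
  then have cardP: "card P < n\<^sup>2" by (simp add: card_cartesian_product n_def power2_eq_square)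
  have bad_le: "real (card (bad p)) \<le> 2 ^ card (edges G) / (real n)\<^sup>2" if "p \<in> P" for p
  proof -
    obtain u v where p: "p = (u, v)" by fastforce
    have uv: "u \<in> pverts G" "v \<in> pverts G" "u \<noteq> v" using that by (auto simp: P_def p)
    let ?c = "card (neighbours G u \<inter> neighbours G v)"
    have "real (card (bad p) * 4 ^ ?c) = real (3 ^ ?c * 2 ^ card (edges G))"
      using card_orientations_without_two_path[OF uv(3), of idx] by (simp add: bad_def p)
    then have "real (card (bad p)) = (3 / 4) ^ ?c * 2 ^ card (edges G)"
      by (simp add: power_divide field_simps)
    moreover have "2 * real (min_degree G) \<le> real ?c + real n"
      using common_neighbours_ge[OF uv(1,2)] unfolding n_def by linarith
    \<comment> \<open>Doubling the degree hypothesis produces a summand \<open>real n\<close> that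
      cancels, leaving c \<ge> 2 ln n / ln (4/3).\<close>
    then have "(3 / 4) ^ ?c \<le> 1 / (real n)\<^sup>2"
      using assms(2) by (intro three_quarters_power_le[OF n0]) (simp add: n_def[symmetric])
    ultimately show ?thesis
      using mult_right_mono[of "(3 / 4) ^ ?c" "1 / (real n)\<^sup>2" "2 ^ card (edges G)"] by simp
  qed
  have "real (card (\<Union>p\<in>P. bad p)) \<le> (\<Sum>p\<in>P. real (card (bad p)))"
    using card_UN_le[OF finP, of bad] by (metis of_nat_mono of_nat_sum)
  also have "\<dots> \<le> real (card P) * (2 ^ card (edges G) / (real n)\<^sup>2)"
    using bad_le by (rule sum_bounded_above)
  also have "\<dots> < (real n)\<^sup>2 * (2 ^ card (edges G) / (real n)\<^sup>2)"
  proof (rule mult_strict_right_mono)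
    show "real (card P) < (real n)\<^sup>2"
      using cardP by (metis of_nat_less_iff of_nat_power)
  qed (use n0 in simp)
  also have "\<dots> = real (card (Pow (edges G)))"
    using n0 finite_edges by (simp add: card_Pow)
  finally have "card (\<Union>p\<in>P. bad p) < card (Pow (edges G))" by linarith
  then have "\<not> Pow (edges G) \<subseteq> (\<Union>p\<in>P. bad p)"
    using card_mono[of "\<Union>p\<in>P. bad p" "Pow (edges G)"] finP finite_edges
    by (fastforce simp: bad_def split: prod.splits)
  then obtain S where S: "S \<subseteq> edges G" "\<forall>p\<in>P. S \<notin> bad p" by blast
  show thesis
  proof (rule that)
    show "is_orientation G (orient idx G S)" using idx by (rule orient_is_orientation)
    show "\<exists>w. (u, w) \<in> parcs (orient idx G S) \<and> (w, v) \<in> parcs (orient idx G S)"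
      if "u \<in> pverts G" "v \<in> pverts G" "u \<noteq> v" for u v
      using S that by (auto simp: P_def bad_def)
  qed
qed

section \<open>Bounds on the diameter of an orientation\<close>

lemma orientation_diameter_ge_2:
  assumes D: "is_orientation G D" and "card (pverts G) \<ge> 2"
  shows "digraph_diameter (with_proj D) \<ge> 2"
proof -
  obtain u v where "u \<in> pverts G" "v \<in> pverts G" "u \<noteq> v"
    using assms(2) by (metis card_le_Suc0_iff_eq pair_finite_verts not_less_eq_eq numeral_2_eq_2)
  moreover have "\<not> ((u, v) \<in> parcs D \<and> (v, u) \<in> parcs D)"
    using D by (auto simp: is_orientation_def)
  \<comment> \<open>Opposite arcs never both survive, so one of the two ordered pairs has no arc. A
    path between its ends has length neither 0 nor 1; if no path exists, the distance is infinite
    and the bound still holds.\<close>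
  ultimately obtain a b where ab: "a \<in> pverts D" "b \<in> pverts D" "a \<noteq> b" "(a, b) \<notin> parcs D"
    using D by (auto simp: is_orientation_def)
  have "2 \<le> enat (length p)" if "pre_digraph.apath (with_proj D) a p b" for p
  proof -
    have p: "set p \<subseteq> parcs D" "pre_digraph.cas (with_proj D) a p b"
      using that by (auto simp: pre_digraph.apath_def pre_digraph.awalk_def)
    have "p \<noteq> []" using p ab by (auto simp: pre_digraph.cas.simps)
    moreover have "p \<noteq> [e]" for e
      using p ab by (cases e) (auto simp: pre_digraph.cas.simps)
    ultimately have "2 \<le> length p"
      by (cases p; cases "tl p") auto
    then show ?thesis by (simp add: numeral_eq_enat)
  qed
  then have "2 \<le> digraph_dist (with_proj D) a b"
    unfolding digraph_dist_def by (intro INF_greatest) auto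
  also have "\<dots> \<le> digraph_diameter (with_proj D)"
    unfolding digraph_diameter_def using ab
    by (intro SUP_upper2[of "(a, b)"]) auto
  finally show ?thesis .
qed

lemma two_paths_diameter_le_2:
  assumes D: "is_orientation G D" and "pverts G \<noteq> {}"
    and paths: "\<And>u v. \<lbrakk>u \<in> pverts G; v \<in> pverts G; u \<noteq> v\<rbrakk> \<Longrightarrow>
      \<exists>w. (u, w) \<in> parcs D \<and> (w, v) \<in> parcs D"
  shows "digraph_diameter (with_proj D) \<le> 2" and "strongly_connected (with_proj D)"
proof -
  have V: "pverts D = pverts G" and sub: "parcs D \<subseteq> parcs G"
    using D by (auto simp: is_orientation_def)
  interpret D: pair_wf_digraph D
    using in_arcsD1 in_arcsD2 sub V by unfold_locales auto
  have ex: "\<exists>p. pre_digraph.apath (with_proj D) u p v \<and> length p \<le> 2"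
    if uv: "u \<in> pverts G" "v \<in> pverts G" for u v
  proof (cases "u = v")
    case True
    \<comment> \<open>The supremum in \<open>digraph_diameter\<close> also ranges over diagonal
      pairs, which the empty path serves.\<close>
    then have "pre_digraph.apath (with_proj D) u [] v"
      using uv V by (simp add: pre_digraph.apath_def pre_digraph.awalk_def pre_digraph.cas.simps
          pre_digraph.awalk_verts.simps)
    then show ?thesis by fastforce
  next
    case False
    then obtain w where w: "(u, w) \<in> parcs D" "(w, v) \<in> parcs D" using paths uv by blast
    \<comment> \<open>An \<open>apath\<close> must not repeat vertices; loop-freeness of
      \<open>G\<close> keeps the midpoint apart from both ends.\<close>
    then have "w \<noteq> u" "w \<noteq> v" using w[THEN subsetD[OF sub], THEN no_loops] by auto
    then have "pre_digraph.apath (with_proj D) u [(u, w), (w, v)] v"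
      using uv V w False by (simp add: pre_digraph.apath_def pre_digraph.awalk_def
          pre_digraph.cas.simps pre_digraph.awalk_verts.simps)
    then show ?thesis by fastforce
  qed
  have "digraph_dist (with_proj D) u v \<le> 2" if uv: "u \<in> pverts G" "v \<in> pverts G" for u v
  proof -
    obtain p where p: "pre_digraph.apath (with_proj D) u p v" "length p \<le> 2"
      using ex[OF uv] by blast
    have "digraph_dist (with_proj D) u v \<le> enat (length p)"
      unfolding digraph_dist_def using p(1) by (intro INF_lower) simp
    also have "\<dots> \<le> 2" using p(2) by (simp add: numeral_eq_enat)
    finally show ?thesis .
  qed
  then show "digraph_diameter (with_proj D) \<le> 2"
    unfolding digraph_diameter_def using V by (intro SUP_least) auto
  show "strongly_connected (with_proj D)"
  proof (rule strongly_connectedI)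
    show "verts (with_proj D) \<noteq> {}" using assms(2) V by simp
    show "u \<rightarrow>\<^sup>*\<^bsub>with_proj D\<^esub> v" if "u \<in> verts (with_proj D)" "v \<in> verts (with_proj D)" for u v
      using ex[of u v] that V by (auto simp: D.reachable_awalk pre_digraph.apath_def)
  qed
qed

end

theorem theorem1:
  fixes G :: "'a pair_pre_digraph" and n :: nat
  assumes "pair_graph G"
    and "pverts G \<noteq> {}"
    and "card (pverts G) = n"
    and "real (min_degree G) \<ge> real n / 2 + ln (real n) / ln (4 / 3)"
  shows "oriented_diameter G = 2 \<and>
    (\<exists>D. is_orientation G D \<and> strongly_connected (with_proj D) \<and>
         digraph_diameter (with_proj D) = 2)"
proof -
  interpret pair_graph G by fact
  have "n > 0" using assms(2,3) pair_finite_verts by (auto simp: card_gt_0_iff)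
  \<comment> \<open>The degree hypothesis forces a positive minimum degree, which excludes the
    one-vertex graph, whose diameter would be 0.\<close>
  then have "ln (real n) / ln (4 / 3) \<ge> 0" by simp
  then have "real (min_degree G) > 0" using assms(4) \<open>n > 0\<close> by linarith
  then have n2: "card (pverts G) \<ge> 2" using min_degree_less[OF assms(2)] by linarith
  obtain D where D: "is_orientation G D"
    and paths: "\<And>u v. \<lbrakk>u \<in> pverts G; v \<in> pverts G; u \<noteq> v\<rbrakk> \<Longrightarrow>
      \<exists>w. (u, w) \<in> parcs D \<and> (w, v) \<in> parcs D"
    using exists_orientation_with_two_paths assms by metis
  note le = two_paths_diameter_le_2[OF D assms(2) paths]
  have eq: "digraph_diameter (with_proj D) = 2"
    using le(1) orientation_diameter_ge_2[OF D n2] by (rule antisym)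
  have "oriented_diameter G = 2"
  proof (rule antisym)
    show "oriented_diameter G \<le> 2"
      unfolding oriented_diameter_def using D le(2) eq by (intro INF_lower2[of D]) auto
    \<comment> \<open>The lower bound holds for every orientation, hence for the infimum.\<close>
    show "2 \<le> oriented_diameter G"
      unfolding oriented_diameter_def
      using orientation_diameter_ge_2[OF _ n2] by (intro INF_greatest) auto
  qed
  then show ?thesis using D le(2) eq by blast
qed

end
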